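(* Let $H$ be a $d$-dimensional semisimple Hopf algebra over an algebraically closed field $k$ of characteristic $0$, with irreducible modules $V_i$, irreducible characters $\chi_i$ and degrees $d_i=\dim V_i$. Assume that $d_i\mid d$ for every irreducible $H$-module $V_i$. Then the functions $$f_{rob}=\sum_i\frac{d}{d_i}\chi_i,\qquad f_n=\sum_i\left(\frac{d}{d_i}\right)^{2n-1}\chi_i\quad(n\ge1),\qquad f_{\{\{x,y\},z\}}=d^2\sum_{i,j}\frac{1}{d_id_j}\langle\chi_i\,s(\chi_i)\,\chi_j,\Lambda\rangle\,\chi_i$$ are characters of $H$.
   Context: $s$ is the antipode of $H^*$, and products of characters are taken in the algebra $H^*$. $\Lambda$ is the idempotent integral of $H$: $h\Lambda=\varepsilon(h)\Lambda=\Lambda h$ for all $h\in H$ and $\varepsilon(\Lambda)=1$, where $\varepsilon$ is the counit. A character of $H$ is the character of a finite-dimensional $H$-module. *)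

theory Defs
  imports
    "HOL-Library.Poly_Mapping"
    "HOL-Computational_Algebra.Computational_Algebra"
    "Jordan_Normal_Form.Matrix"
begin

section \<open>Tensor squares and tensor cubes\<close>

text \<open>
  A list of pairs \<open>[(x\<^sub>1, y\<^sub>1), ..., (x\<^sub>m, y\<^sub>m)]\<close> stands for the element
  \<open>x\<^sub>1 \<otimes> y\<^sub>1 + ... + x\<^sub>m \<otimes> y\<^sub>m\<close> of \<open>H \<otimes> H\<close>, and a list of triples stands likewise for an
  element of \<open>H \<otimes> H \<otimes> H\<close>. The tensor product is the usual quotient of the free vector space on
  all pairs (triples) by the subspace spanned by the multilinearity relations; \<open>tensor2_eq\<close>
  and \<open>tensor3_eq\<close> say that two lists stand for the same element of that quotient.
\<close>

definition free_scale :: "'k::field \<Rightarrow> ('a \<Rightarrow>\<^sub>0 'k) \<Rightarrow> ('a \<Rightarrow>\<^sub>0 'k)" where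
  "free_scale c = Poly_Mapping.map ((*) c)"

abbreviation gen :: "'a \<Rightarrow> ('a \<Rightarrow>\<^sub>0 'k::field)" where
  "gen p \<equiv> Poly_Mapping.single p 1"

definition formal_sum :: "'a list \<Rightarrow> ('a \<Rightarrow>\<^sub>0 'k::field)" where
  "formal_sum ps = (\<Sum>p\<leftarrow>ps. gen p)"

definition bilinear_relations ::
    "('k::field \<Rightarrow> 'h \<Rightarrow> 'h::ab_group_add) \<Rightarrow> ('h \<times> 'h \<Rightarrow>\<^sub>0 'k) set" where
  "bilinear_relations scale =
     {gen (x + x', y) - gen (x, y) - gen (x', y) | x x' y. True} \<union>
     {gen (x, y + y') - gen (x, y) - gen (x, y') | x y y'. True} \<union>
     {gen (scale c x, y) - free_scale c (gen (x, y)) | c x y. True} \<union>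
     {gen (x, scale c y) - free_scale c (gen (x, y)) | c x y. True}"

definition trilinear_relations ::
    "('k::field \<Rightarrow> 'h \<Rightarrow> 'h::ab_group_add) \<Rightarrow> ('h \<times> 'h \<times> 'h \<Rightarrow>\<^sub>0 'k) set" where
  "trilinear_relations scale =
     {gen (x + x', y, z) - gen (x, y, z) - gen (x', y, z) | x x' y z. True} \<union>
     {gen (x, y + y', z) - gen (x, y, z) - gen (x, y', z) | x y y' z. True} \<union>
     {gen (x, y, z + z') - gen (x, y, z) - gen (x, y, z') | x y z z'. True} \<union>
     {gen (scale c x, y, z) - free_scale c (gen (x, y, z)) | c x y z. True} \<union>
     {gen (x, scale c y, z) - free_scale c (gen (x, y, z)) | c x y z. True} \<union>
     {gen (x, y, scale c z) - free_scale c (gen (x, y, z)) | c x y z. True}"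

definition tensor2_eq ::
    "('k::field \<Rightarrow> 'h \<Rightarrow> 'h::ab_group_add) \<Rightarrow> ('h \<times> 'h) list \<Rightarrow> ('h \<times> 'h) list \<Rightarrow> bool" where
  "tensor2_eq scale s t \<longleftrightarrow>
     formal_sum s - formal_sum t \<in> Modules.module.span free_scale (bilinear_relations scale)"

definition tensor3_eq ::
    "('k::field \<Rightarrow> 'h \<Rightarrow> 'h::ab_group_add) \<Rightarrow>
     ('h \<times> 'h \<times> 'h) list \<Rightarrow> ('h \<times> 'h \<times> 'h) list \<Rightarrow> bool" where
  "tensor3_eq scale s t \<longleftrightarrow>
     formal_sum s - formal_sum t \<in> Modules.module.span free_scale (trilinear_relations scale)"


section \<open>Hopf algebras\<close>

text \<open>
  The ring structure of \<open>H\<close> is that of the type \<open>'h\<close>. The list \<open>\<Delta> x\<close> is a chosen representative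
  of the coproduct of \<open>x\<close>, i.e. of Sweedler's sum of \<open>x\<^sub>1 \<otimes> x\<^sub>2\<close>; the axioms constrain only the
  tensor it stands for.
\<close>

locale hopf_algebra = vector_space scale
  for scale :: "'k::field \<Rightarrow> 'h::ring_1 \<Rightarrow> 'h" +
  fixes \<Delta> :: "'h \<Rightarrow> ('h \<times> 'h) list"
    and \<epsilon> :: "'h \<Rightarrow> 'k"
    and S :: "'h \<Rightarrow> 'h"
  assumes scale_mult_left: "scale c x * y = scale c (x * y)"
    and scale_mult_right: "x * scale c y = scale c (x * y)"
    and comult_add: "tensor2_eq scale (\<Delta> (x + y)) (\<Delta> x @ \<Delta> y)"
    and comult_scale: "tensor2_eq scale (\<Delta> (scale c x)) [(scale c a, b). (a, b) \<leftarrow> \<Delta> x]"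
    and counit_linear: "Vector_Spaces.linear scale (*) \<epsilon>"
    and coassoc: "tensor3_eq scale
          [(a1, a2, b). (a, b) \<leftarrow> \<Delta> x, (a1, a2) \<leftarrow> \<Delta> a]
          [(a, b1, b2). (a, b) \<leftarrow> \<Delta> x, (b1, b2) \<leftarrow> \<Delta> b]"
    and counit_left: "(\<Sum>(a, b)\<leftarrow>\<Delta> x. scale (\<epsilon> a) b) = x"
    and counit_right: "(\<Sum>(a, b)\<leftarrow>\<Delta> x. scale (\<epsilon> b) a) = x"
    and comult_one: "tensor2_eq scale (\<Delta> 1) [(1, 1)]"
    and comult_mult: "tensor2_eq scale (\<Delta> (x * y))
          [(a * c, b * d). (a, b) \<leftarrow> \<Delta> x, (c, d) \<leftarrow> \<Delta> y]"
    and counit_one: "\<epsilon> 1 = 1"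
    and counit_mult: "\<epsilon> (x * y) = \<epsilon> x * \<epsilon> y"
    and antipode_linear: "Vector_Spaces.linear scale scale S"
    and antipode_left: "(\<Sum>(a, b)\<leftarrow>\<Delta> x. S a * b) = scale (\<epsilon> x) 1"
    and antipode_right: "(\<Sum>(a, b)\<leftarrow>\<Delta> x. a * S b) = scale (\<epsilon> x) 1"

definition finite_dimensional :: "('k::field \<Rightarrow> 'h \<Rightarrow> 'h::ab_group_add) \<Rightarrow> bool" where
  "finite_dimensional scale \<longleftrightarrow> (\<exists>B. finite_dimensional_vector_space scale B)"

text \<open>
  Semisimplicity of the regular left module. Left ideals are automatically \<open>k\<close>-subspaces.
\<close>

definition left_ideal :: "'h::ring_1 set \<Rightarrow> bool" where
  "left_ideal L \<longleftrightarrow> 0 \<in> L \<and> (\<forall>x\<in>L. \<forall>y\<in>L. x + y \<in> L) \<and> (\<forall>h. \<forall>x\<in>L. h * x \<in> L)"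

definition semisimple_ring :: "'h::ring_1 itself \<Rightarrow> bool" where
  "semisimple_ring (_ :: 'h itself) \<longleftrightarrow>
     (\<forall>L :: 'h set. left_ideal L \<longrightarrow>
        (\<exists>L'. left_ideal L' \<and> L \<inter> L' = {0} \<and> (\<forall>h. \<exists>x\<in>L. \<exists>y\<in>L'. h = x + y)))"

definition idempotent_integral ::
    "('k::field \<Rightarrow> 'h \<Rightarrow> 'h::ring_1) \<Rightarrow> ('h \<Rightarrow> 'k) \<Rightarrow> 'h \<Rightarrow> bool" where
  "idempotent_integral scale \<epsilon> \<Lambda> \<longleftrightarrow>
     (\<forall>h. h * \<Lambda> = scale (\<epsilon> h) \<Lambda> \<and> \<Lambda> * h = scale (\<epsilon> h) \<Lambda>) \<and> \<epsilon> \<Lambda> = 1"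

text \<open>Product and antipode of the dual Hopf algebra; its elements are linear functionals on \<open>H\<close>.\<close>

definition dual_mult ::
    "('h \<Rightarrow> ('h \<times> 'h) list) \<Rightarrow> ('h \<Rightarrow> 'k::field) \<Rightarrow> ('h \<Rightarrow> 'k) \<Rightarrow> 'h \<Rightarrow> 'k" where
  "dual_mult \<Delta> f g = (\<lambda>h. \<Sum>(a, b)\<leftarrow>\<Delta> h. f a * g b)"

definition dual_antipode :: "('h \<Rightarrow> 'h) \<Rightarrow> ('h \<Rightarrow> 'k) \<Rightarrow> 'h \<Rightarrow> 'k" where
  "dual_antipode S f = (\<lambda>h. f (S h))"


section \<open>Finite-dimensional modules and characters\<close>

text \<open>
  An \<open>n\<close>-dimensional module is given, after the choice of a basis, by a matrix representation
  on \<open>k\<^sup>n\<close>. The zero module (\<open>n = 0\<close>) is allowed, but it is not irreducible.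
\<close>

definition representation ::
    "('k::field \<Rightarrow> 'h \<Rightarrow> 'h::ring_1) \<Rightarrow> nat \<Rightarrow> ('h \<Rightarrow> 'k mat) \<Rightarrow> bool" where
  "representation scale n \<rho> \<longleftrightarrow>
     (\<forall>h. \<rho> h \<in> carrier_mat n n) \<and>
     (\<forall>g h. \<rho> (g + h) = \<rho> g + \<rho> h) \<and>
     (\<forall>c h. \<rho> (scale c h) = c \<cdot>\<^sub>m \<rho> h) \<and>
     \<rho> 1 = 1\<^sub>m n \<and>
     (\<forall>g h. \<rho> (g * h) = \<rho> g * \<rho> h)"

definition submodule_of :: "nat \<Rightarrow> ('h \<Rightarrow> 'k::field mat) \<Rightarrow> 'k vec set \<Rightarrow> bool" where
  "submodule_of n \<rho> W \<longleftrightarrow>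
     W \<subseteq> carrier_vec n \<and> 0\<^sub>v n \<in> W \<and>
     (\<forall>v\<in>W. \<forall>w\<in>W. v + w \<in> W) \<and>
     (\<forall>c. \<forall>v\<in>W. c \<cdot>\<^sub>v v \<in> W) \<and>
     (\<forall>h. \<forall>v\<in>W. \<rho> h *\<^sub>v v \<in> W)"

definition irreducible_representation ::
    "('k::field \<Rightarrow> 'h \<Rightarrow> 'h::ring_1) \<Rightarrow> nat \<Rightarrow> ('h \<Rightarrow> 'k mat) \<Rightarrow> bool" where
  "irreducible_representation scale n \<rho> \<longleftrightarrow>
     representation scale n \<rho> \<and> n > 0 \<and>
     (\<forall>W. submodule_of n \<rho> W \<longrightarrow> W = {0\<^sub>v n} \<or> W = carrier_vec n)"

definition isomorphic_representations ::
    "nat \<Rightarrow> ('h \<Rightarrow> 'k::field mat) \<Rightarrow> nat \<Rightarrow> ('h \<Rightarrow> 'k mat) \<Rightarrow> bool" where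
  "isomorphic_representations m \<rho> n \<sigma> \<longleftrightarrow>
     m = n \<and> (\<exists>P \<in> carrier_mat n n. invertible_mat P \<and> (\<forall>h. P * \<rho> h = \<sigma> h * P))"

text \<open>
  \<open>(\<rho> i)\<^sub>i\<close>, of degrees \<open>deg i\<close>, is a complete irredundant list of irreducible modules up to
  isomorphism.
\<close>

definition irreducible_modules ::
    "('k::field \<Rightarrow> 'h \<Rightarrow> 'h::ring_1) \<Rightarrow> 'i set \<Rightarrow> ('i \<Rightarrow> nat) \<Rightarrow> ('i \<Rightarrow> 'h \<Rightarrow> 'k mat) \<Rightarrow> bool" where
  "irreducible_modules scale I deg \<rho> \<longleftrightarrow>
     finite I \<and>
     (\<forall>i\<in>I. irreducible_representation scale (deg i) (\<rho> i)) \<and>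
     (\<forall>i\<in>I. \<forall>j\<in>I. isomorphic_representations (deg i) (\<rho> i) (deg j) (\<rho> j) \<longrightarrow> i = j) \<and>
     (\<forall>n \<sigma>. irreducible_representation scale n \<sigma> \<longrightarrow>
        (\<exists>i\<in>I. isomorphic_representations n \<sigma> (deg i) (\<rho> i)))"

definition mat_trace :: "'k::field mat \<Rightarrow> 'k" where
  "mat_trace A = (\<Sum>i<dim_row A. A $$ (i, i))"

definition character_of :: "('h \<Rightarrow> 'k::field mat) \<Rightarrow> 'h \<Rightarrow> 'k" where
  "character_of \<rho> = (\<lambda>h. mat_trace (\<rho> h))"

definition is_character :: "('k::field \<Rightarrow> 'h \<Rightarrow> 'h::ring_1) \<Rightarrow> ('h \<Rightarrow> 'k) \<Rightarrow> bool" where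
  "is_character scale f \<longleftrightarrow> (\<exists>n \<rho>. representation scale n \<rho> \<and> f = character_of \<rho>)"

end

theory Submission
  imports Defs
begin

text \<open>
  A combination of characters with natural-number coefficients is the character of a direct sum of
  modules, so each of the three functions is a character once the coefficients of the irreducible
  characters \<open>\<chi>\<^sub>i\<close> are natural numbers. For the first two functions this is the assumption that
  \<open>d\<^sub>i\<close> divides \<open>d\<close>.

  In the third function the coefficient of \<open>\<chi>\<^sub>i\<close> is
  \<open>\<Sum>\<^sub>j (d / d\<^sub>i) (d / d\<^sub>j) \<langle>\<chi>\<^sub>i s(\<chi>\<^sub>i) \<chi>\<^sub>j, \<Lambda>\<rangle>\<close>, so it is enough that the pairings with \<open>\<Lambda>\<close> are natural
  numbers. The product of two characters is the character of the tensor product module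
  (\<open>is_character_dual_mult\<close>), and \<open>s\<close> sends a character to that of the dual module
  (\<open>is_character_dual_antipode\<close>); the latter needs that \<open>S\<close> reverses products (\<open>antipode_mult\<close>).
  Hence \<open>\<chi>\<^sub>i s(\<chi>\<^sub>i) \<chi>\<^sub>j\<close> is the character of \<open>V\<^sub>i \<otimes> V\<^sub>i\<^sup>* \<otimes> V\<^sub>j\<close>. Since \<open>\<Lambda>\<close> is an idempotent of \<open>H\<close>, it
  acts on this module by an idempotent matrix, and the trace of such a matrix is a natural number
  (\<open>trace_idempotent_in_Nats\<close>): here it is the multiplicity of the trivial module.
\<close>

section \<open>Evaluating multilinear maps on tensors\<close>

definition pair_sum :: "('h \<Rightarrow> 'h \<Rightarrow> 'v::comm_monoid_add) \<Rightarrow> ('h \<times> 'h) list \<Rightarrow> 'v" where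
  "pair_sum B t = (\<Sum>(a, b)\<leftarrow>t. B a b)"

lemma pair_sum_Nil [simp]: "pair_sum B [] = 0"
  and pair_sum_Cons [simp]: "pair_sum B (p # t) = B (fst p) (snd p) + pair_sum B t"
  and pair_sum_append [simp]: "pair_sum B (t @ u) = pair_sum B t + pair_sum B u"
  by (simp_all add: pair_sum_def split_beta)

lemma pair_sum_mult_left:
  fixes c :: "'v::semiring_0"
  shows "c * pair_sum B t = pair_sum (\<lambda>a b. c * B a b) t"
  by (induction t) (simp_all add: distrib_left)

lemma pair_sum_mult_right:
  fixes c :: "'v::semiring_0"
  shows "pair_sum B t * c = pair_sum (\<lambda>a b. B a b * c) t"
  by (induction t) (simp_all add: distrib_right)

lemma pair_sum_add: "pair_sum (\<lambda>a b. B a b + C a b) t = pair_sum B t + pair_sum C t"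
  by (induction t) (simp_all add: algebra_simps)

lemma pair_sum_zero: "pair_sum (\<lambda>a b. 0) t = 0"
  by (induction t) simp_all

lemma pair_sum_swap:
  "pair_sum (\<lambda>a b. pair_sum (\<lambda>c d. F a b c d) u) t = pair_sum (\<lambda>c d. pair_sum (\<lambda>a b. F a b c d) t) u"
  by (induction t) (simp_all add: pair_sum_add pair_sum_zero)

lemma pair_sum_sum:
  "pair_sum (\<lambda>a b. \<Sum>i\<in>A. F i a b) t = (\<Sum>i\<in>A. pair_sum (F i) t)"
  by (induction t) (simp_all add: sum.distrib)

lemma pair_sum_linear:
  assumes "Vector_Spaces.linear s1 s2 f"
  shows "f (pair_sum B t) = pair_sum (\<lambda>a b. f (B a b)) t"
proof -
  interpret Vector_Spaces.linear s1 s2 f by (rule assms)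
  show ?thesis by (induction t) (simp_all add: zero add)
qed

lemma pair_sum_concat:
  "pair_sum B [(a * c, b * d). (a, b) \<leftarrow> t, (c, d) \<leftarrow> u] =
     pair_sum (\<lambda>a b. pair_sum (\<lambda>c d. B (a * c) (b * d)) u) t"
proof -
  have "pair_sum B (map (\<lambda>(c, d). (a * c, b * d)) u) = pair_sum (\<lambda>c d. B (a * c) (b * d)) u" for a b
    by (induction u) auto
  then show ?thesis by (induction t) auto
qed

definition linear_extension ::
    "('k::field \<Rightarrow> 'v \<Rightarrow> 'v::ab_group_add) \<Rightarrow> ('a \<Rightarrow> 'v) \<Rightarrow> ('a \<Rightarrow>\<^sub>0 'k) \<Rightarrow> 'v" where
  "linear_extension s F f = (\<Sum>p\<in>Poly_Mapping.keys f. s (Poly_Mapping.lookup f p) (F p))"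

lemma lookup_free_scale: "Poly_Mapping.lookup (free_scale c f) p = c * Poly_Mapping.lookup f p"
  unfolding free_scale_def by (cases "Poly_Mapping.lookup f p = 0") (simp_all add: Poly_Mapping.map.rep_eq)

lemma vector_space_free_scale: "vector_space (free_scale :: 'k::field \<Rightarrow> _ \<Rightarrow> ('a \<Rightarrow>\<^sub>0 'k))"
  by unfold_locales
    (auto intro!: poly_mapping_eqI simp: lookup_free_scale lookup_add algebra_simps)

lemma linear_linear_extension:
  assumes "vector_space s"
  shows "Vector_Spaces.linear free_scale s (linear_extension s F)"
proof -
  interpret vector_space s by (rule assms)
  have on_superset: "linear_extension s F f = (\<Sum>p\<in>A. s (Poly_Mapping.lookup f p) (F p))"
    if "finite A" "Poly_Mapping.keys f \<subseteq> A" for A f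
    unfolding linear_extension_def
    by (rule sum.mono_neutral_left) (use that in \<open>auto simp: in_keys_iff\<close>)
  have "linear_extension s F (f + g) = linear_extension s F f + linear_extension s F g" for f g
  proof -
    let ?A = "Poly_Mapping.keys f \<union> Poly_Mapping.keys g"
    have "Poly_Mapping.keys (f + g) \<subseteq> ?A" by (rule Poly_Mapping.keys_add)
    then show ?thesis
      using on_superset[of ?A f] on_superset[of ?A g] on_superset[of ?A "f + g"]
      by (simp add: lookup_add scale_left_distrib sum.distrib)
  qed
  moreover have "linear_extension s F (free_scale c f) = s c (linear_extension s F f)" for c f
  proof -
    have "Poly_Mapping.keys (free_scale c f) \<subseteq> Poly_Mapping.keys f"
      by (auto simp: in_keys_iff lookup_free_scale)
    then show ?thesis
      using on_superset[of "Poly_Mapping.keys f" f] on_superset[of "Poly_Mapping.keys f" "free_scale c f"]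
      by (simp add: lookup_free_scale scale_sum_right)
  qed
  ultimately show ?thesis
    by (simp add: Vector_Spaces.linear_iff vector_space_free_scale assms)
qed

lemma linear_extension_gen:
  assumes "vector_space s"
  shows "linear_extension s F (gen p) = F p"
proof -
  interpret vector_space s by (rule assms)
  show ?thesis by (simp add: linear_extension_def)
qed

lemma linear_extension_formal_sum:
  assumes "vector_space s"
  shows "linear_extension s F (formal_sum t) = (\<Sum>p\<leftarrow>t. F p)"
proof -
  interpret linear_ext: Vector_Spaces.linear free_scale s "linear_extension s F"
    by (rule linear_linear_extension[OF assms])
  show ?thesis
    by (induction t)
      (simp_all add: formal_sum_def linear_ext.zero linear_ext.add linear_extension_gen[OF assms])
qed

text \<open>
  A linear map on the free vector space that kills the relations factors through the quotient by
  them. This is the universal property of the tensor product, for any set of relations.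
\<close>

lemma relations_respected:
  assumes "vector_space s"
    and "\<And>r. r \<in> R \<Longrightarrow> linear_extension s F r = 0"
    and "formal_sum t - formal_sum u \<in> Modules.module.span free_scale R"
  shows "(\<Sum>p\<leftarrow>t. F p) = (\<Sum>p\<leftarrow>u. F p)"
proof -
  interpret linear_ext: Vector_Spaces.linear free_scale s "linear_extension s F"
    by (rule linear_linear_extension[OF assms(1)])
  have "linear_extension s F (formal_sum t - formal_sum u) = 0"
    using assms(3)
    by (rule linear_ext.eq_0_on_span[rotated]) (rule assms(2))
  then show ?thesis
    by (simp add: linear_ext.diff linear_extension_formal_sum[OF assms(1)])
qed

definition bilinear_map ::
    "('k::field \<Rightarrow> 'h \<Rightarrow> 'h::ab_group_add) \<Rightarrow> ('k \<Rightarrow> 'v \<Rightarrow> 'v::ab_group_add) \<Rightarrow>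
     ('h \<Rightarrow> 'h \<Rightarrow> 'v) \<Rightarrow> bool" where
  "bilinear_map s s' B \<longleftrightarrow>
     (\<forall>y. Vector_Spaces.linear s s' (\<lambda>x. B x y)) \<and> (\<forall>x. Vector_Spaces.linear s s' (B x))"

definition trilinear_map ::
    "('k::field \<Rightarrow> 'h \<Rightarrow> 'h::ab_group_add) \<Rightarrow> ('k \<Rightarrow> 'v \<Rightarrow> 'v::ab_group_add) \<Rightarrow>
     ('h \<Rightarrow> 'h \<Rightarrow> 'h \<Rightarrow> 'v) \<Rightarrow> bool" where
  "trilinear_map s s' T \<longleftrightarrow>
     (\<forall>y z. Vector_Spaces.linear s s' (\<lambda>x. T x y z)) \<and> (\<forall>x. bilinear_map s s' (T x))"

text \<open>
  By this lemma and its trilinear analogue, each Hopf algebra axiom about tensors becomes an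
  equation between values of multilinear maps, which is the form in which the axioms are used.
\<close>

lemma pair_sum_respects_tensor2_eq:
  assumes "bilinear_map s s' B" and "tensor2_eq s t u"
  shows "pair_sum B t = pair_sum B u"
proof -
  have vs: "vector_space s'"
    using assms(1) by (simp add: bilinear_map_def Vector_Spaces.linear_iff)
  interpret le: Vector_Spaces.linear free_scale s' "linear_extension s' (\<lambda>(a, b). B a b)"
    by (rule linear_linear_extension[OF vs])
  have "linear_extension s' (\<lambda>(a, b). B a b) r = 0" if "r \<in> bilinear_relations s" for r
    using that assms(1)
    by (auto simp: bilinear_relations_def bilinear_map_def Vector_Spaces.linear_iff le.diff
        le.scale linear_extension_gen[OF vs])
  from relations_respected[OF vs this assms(2)[unfolded tensor2_eq_def]]
  show ?thesis by (simp add: pair_sum_def)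
qed

lemma sum_list_respects_tensor3_eq:
  assumes "trilinear_map s s' T" and "tensor3_eq s t u"
  shows "(\<Sum>(a, b, c)\<leftarrow>t. T a b c) = (\<Sum>(a, b, c)\<leftarrow>u. T a b c)"
proof -
  have vs: "vector_space s'"
    using assms(1) by (simp add: trilinear_map_def Vector_Spaces.linear_iff)
  interpret le: Vector_Spaces.linear free_scale s' "linear_extension s' (\<lambda>(a, b, c). T a b c)"
    by (rule linear_linear_extension[OF vs])
  have "linear_extension s' (\<lambda>(a, b, c). T a b c) r = 0" if "r \<in> trilinear_relations s" for r
    using that assms(1)
    by (auto simp: trilinear_relations_def trilinear_map_def bilinear_map_def
        Vector_Spaces.linear_iff le.diff le.scale linear_extension_gen[OF vs])
  from relations_respected[OF vs this assms(2)[unfolded tensor3_eq_def]]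
  show ?thesis .
qed

section \<open>The antipode reverses products\<close>

context hopf_algebra
begin

lemma pair_sum_comult_linear:
  assumes "bilinear_map scale s B"
  shows "Vector_Spaces.linear scale s (\<lambda>x. pair_sum B (\<Delta> x))"
proof -
  have vs: "vector_space s"
    using assms by (simp add: bilinear_map_def Vector_Spaces.linear_iff)
  interpret v: vector_space s by (rule vs)
  have "pair_sum B [(scale c a, b). (a, b) \<leftarrow> t] = s c (pair_sum B t)" for c t
    using assms
    by (induction t) (auto simp: bilinear_map_def Vector_Spaces.linear_iff v.scale_right_distrib)
  then show ?thesis
    using pair_sum_respects_tensor2_eq[OF assms comult_add]
      pair_sum_respects_tensor2_eq[OF assms comult_scale]
    by (simp add: Vector_Spaces.linear_iff vs vector_space_axioms)
qed

lemma pair_sum_comult_one: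
  assumes "bilinear_map scale s B"
  shows "pair_sum B (\<Delta> 1) = B 1 1"
  using pair_sum_respects_tensor2_eq[OF assms comult_one] by simp

lemma pair_sum_comult_mult:
  assumes "bilinear_map scale s B"
  shows "pair_sum B (\<Delta> (x * y)) =
    pair_sum (\<lambda>a b. pair_sum (\<lambda>c d. B (a * c) (b * d)) (\<Delta> y)) (\<Delta> x)"
  using pair_sum_respects_tensor2_eq[OF assms comult_mult] by (simp add: pair_sum_concat)

lemma pair_sum_coassoc:
  assumes "trilinear_map scale s T"
  shows "pair_sum (\<lambda>a b. pair_sum (\<lambda>a1 a2. T a1 a2 b) (\<Delta> a)) (\<Delta> x) =
    pair_sum (\<lambda>a b. pair_sum (T a) (\<Delta> b)) (\<Delta> x)"
proof -
  have l: "(\<Sum>(a, b, c)\<leftarrow>[(a1, a2, b). (a, b) \<leftarrow> t, (a1, a2) \<leftarrow> \<Delta> a]. T a b c) =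
      pair_sum (\<lambda>a b. pair_sum (\<lambda>a1 a2. T a1 a2 b) (\<Delta> a)) t" for t
    by (induction t) (simp_all add: pair_sum_def case_prod_unfold o_def)
  have r: "(\<Sum>(a, b, c)\<leftarrow>[(a, b1, b2). (a, b) \<leftarrow> t, (b1, b2) \<leftarrow> \<Delta> b]. T a b c) =
      pair_sum (\<lambda>a b. pair_sum (T a) (\<Delta> b)) t" for t
    by (induction t) (simp_all add: pair_sum_def case_prod_unfold o_def)
  show ?thesis
    using sum_list_respects_tensor3_eq[OF assms coassoc] by (simp only: l r)
qed

lemma antipode_add: "S (x + y) = S x + S y"
  and antipode_scale: "S (scale c x) = scale c (S x)"
  using antipode_linear by (auto simp: Vector_Spaces.linear_iff)

lemmas hopf_linear_simps = bilinear_map_def trilinear_map_def Vector_Spaces.linear_iff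
  vector_space_axioms antipode_add antipode_scale distrib_left distrib_right
  scale_mult_left scale_mult_right scale_right_distrib

lemma antipode_one: "S 1 = 1"
proof -
  have "bilinear_map scale scale (\<lambda>a b. S a * b)"
    by (simp add: hopf_linear_simps)
  from pair_sum_comult_one[OF this] show ?thesis
    using antipode_left[of 1] by (simp add: pair_sum_def counit_one)
qed

text \<open>
  In Sweedler notation, \<open>\<epsilon>(x) S(y) = \<Sum> \<epsilon>(x y\<^sub>1) S(y\<^sub>2) = \<Sum> S(x\<^sub>1 y\<^sub>1) x\<^sub>2 y\<^sub>2 S(y\<^sub>3) = \<Sum> S(x\<^sub>1 y) x\<^sub>2\<close>.
  Isolating this half of the proof that \<open>S\<close> is an antihomomorphism means that only one
  coproduct at a time has to be reassociated.
\<close>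

lemma antipode_cancel_left_factor:
  "pair_sum (\<lambda>a b. S (a * y) * b) (\<Delta> x) = scale (\<epsilon> x) (S y)"
proof -
  have "scale (\<epsilon> x) (S y) = scale (\<epsilon> x) (S (pair_sum (\<lambda>a b. scale (\<epsilon> a) b) (\<Delta> y)))"
    using counit_left[of y] by (simp add: pair_sum_def)
  also have "\<dots> = pair_sum (\<lambda>a b. scale (\<epsilon> (x * a)) 1 * S b) (\<Delta> y)"
    unfolding pair_sum_linear[OF antipode_linear] pair_sum_linear[OF linear_scale_self]
    by (simp add: antipode_scale counit_mult scale_mult_left)
  also have "\<dots> = pair_sum (\<lambda>a b. pair_sum (\<lambda>u v. S u * v) (\<Delta> (x * a)) * S b) (\<Delta> y)"
    using antipode_left by (simp add: pair_sum_def)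
  also have "\<dots> = pair_sum (\<lambda>x1 x2. pair_sum (\<lambda>a b.
      pair_sum (\<lambda>a1 a2. S (x1 * a1) * (x2 * a2) * S b) (\<Delta> a)) (\<Delta> y)) (\<Delta> x)"
  proof -
    have "bilinear_map scale scale (\<lambda>a b. S a * b)"
      by (simp add: hopf_linear_simps)
    note * = pair_sum_comult_mult[OF this, of x]
    show ?thesis
      unfolding * pair_sum_mult_right by (rule pair_sum_swap)
  qed
  also have "\<dots> = pair_sum (\<lambda>x1 x2. pair_sum (\<lambda>a b.
      pair_sum (\<lambda>b1 b2. S (x1 * a) * (x2 * b1) * S b2) (\<Delta> b)) (\<Delta> y)) (\<Delta> x)"
  proof -
    have "trilinear_map scale scale (\<lambda>a b c. S (x1 * a) * (x2 * b) * S c)" for x1 x2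
      by (simp add: hopf_linear_simps)
    note * = pair_sum_coassoc[OF this, of _ _ y]
    show ?thesis by (simp only: *)
  qed
  also have "\<dots> = pair_sum (\<lambda>x1 x2. pair_sum (\<lambda>a b. S (x1 * scale (\<epsilon> b) a) * x2) (\<Delta> y)) (\<Delta> x)"
  proof -
    have "pair_sum (\<lambda>b1 b2. S (x1 * a) * (x2 * b1) * S b2) (\<Delta> b) =
        S (x1 * scale (\<epsilon> b) a) * x2" for x1 x2 a b
    proof -
      have "pair_sum (\<lambda>b1 b2. S (x1 * a) * (x2 * b1) * S b2) (\<Delta> b) =
          S (x1 * a) * x2 * pair_sum (\<lambda>b1 b2. b1 * S b2) (\<Delta> b)"
        by (simp add: pair_sum_mult_left mult.assoc)
      also have "\<dots> = S (x1 * a) * x2 * scale (\<epsilon> b) 1"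
        using antipode_right[of b] by (simp add: pair_sum_def)
      finally show ?thesis by (simp add: scale_mult_left scale_mult_right antipode_scale)
    qed
    then show ?thesis by simp
  qed
  also have "\<dots> = pair_sum (\<lambda>x1 x2. S (x1 * y) * x2) (\<Delta> x)"
  proof -
    have "Vector_Spaces.linear scale scale (\<lambda>z. S (x1 * z) * x2)" for x1 x2
      by (simp add: hopf_linear_simps)
    from pair_sum_linear[OF this, where B = "\<lambda>a b. scale (\<epsilon> b) a" and t = "\<Delta> y"]
    show ?thesis using counit_right[of y] by (simp add: pair_sum_def)
  qed
  finally show ?thesis ..
qed

text \<open>
  In Sweedler notation, by the preceding lemma applied to \<open>x\<^sub>1\<close>,
  \<open>S(y) S(x) = \<Sum> \<epsilon>(x\<^sub>1) S(y) S(x\<^sub>2) = \<Sum> S(x\<^sub>1 y) x\<^sub>2 S(x\<^sub>3) = S(x y)\<close>.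
\<close>

lemma antipode_mult: "S (x * y) = S y * S x"
proof -
  have "S y * S x = S y * S (pair_sum (\<lambda>a b. scale (\<epsilon> a) b) (\<Delta> x))"
    using counit_left[of x] by (simp add: pair_sum_def)
  also have "\<dots> = pair_sum (\<lambda>a b. scale (\<epsilon> a) (S y) * S b) (\<Delta> x)"
    unfolding pair_sum_linear[OF antipode_linear] pair_sum_mult_left
    by (simp add: antipode_scale scale_mult_left scale_mult_right)
  also have "\<dots> = pair_sum (\<lambda>a b. pair_sum (\<lambda>a1 a2. S (a1 * y) * a2 * S b) (\<Delta> a)) (\<Delta> x)"
    by (simp add: antipode_cancel_left_factor flip: pair_sum_mult_right)
  also have "\<dots> = pair_sum (\<lambda>a b. pair_sum (\<lambda>b1 b2. S (a * y) * b1 * S b2) (\<Delta> b)) (\<Delta> x)"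
    by (rule pair_sum_coassoc[where s = scale]) (simp add: hopf_linear_simps)
  also have "\<dots> = pair_sum (\<lambda>a b. S (scale (\<epsilon> b) a * y)) (\<Delta> x)"
  proof -
    have "pair_sum (\<lambda>b1 b2. S (a * y) * b1 * S b2) (\<Delta> b) = S (scale (\<epsilon> b) a * y)" for a b
    proof -
      have "pair_sum (\<lambda>b1 b2. S (a * y) * b1 * S b2) (\<Delta> b) =
          S (a * y) * pair_sum (\<lambda>b1 b2. b1 * S b2) (\<Delta> b)"
        by (simp add: pair_sum_mult_left mult.assoc)
      also have "\<dots> = S (a * y) * scale (\<epsilon> b) 1"
        using antipode_right[of b] by (simp add: pair_sum_def)
      finally show ?thesis by (simp add: scale_mult_left scale_mult_right antipode_scale)
    qed
    then show ?thesis by simp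
  qed
  also have "\<dots> = S (x * y)"
  proof -
    have "Vector_Spaces.linear scale scale (\<lambda>z. S (z * y))"
      by (simp add: hopf_linear_simps)
    from pair_sum_linear[OF this, of "\<lambda>a b. scale (\<epsilon> b) a" "\<Delta> x"]
    show ?thesis using counit_right[of x] by (simp add: pair_sum_def)
  qed
  finally show ?thesis ..
qed

end

section \<open>Sums, duals and products of characters\<close>

lemma is_character_zero: "is_character scale (\<lambda>h. 0)"
proof -
  have "representation scale 0 (\<lambda>h. 0\<^sub>m 0 0)"
    by (auto simp: representation_def)
  then show ?thesis
    unfolding is_character_def by (intro exI conjI) (auto simp: character_of_def mat_trace_def)
qed

lemma sum_lessThan_add: "(\<Sum>i<m + n. g i) = (\<Sum>i<m. g i) + (\<Sum>i<n. g (m + i :: nat))"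
  by (induction n) (simp_all add: add.assoc)

lemma is_character_add:
  assumes "is_character scale f" and "is_character scale g"
  shows "is_character scale (\<lambda>h. f h + g h)"
proof -
  obtain m \<rho> where \<rho>: "representation scale m \<rho>" "f = character_of \<rho>"
    using assms(1) by (auto simp: is_character_def)
  obtain n \<sigma> where \<sigma>: "representation scale n \<sigma>" "g = character_of \<sigma>"
    using assms(2) by (auto simp: is_character_def)
  define \<tau> where "\<tau> h = four_block_mat (\<rho> h) (0\<^sub>m m n) (0\<^sub>m n m) (\<sigma> h)" for h
  have c: "\<rho> h \<in> carrier_mat m m" "\<sigma> h \<in> carrier_mat n n" for h
    using \<rho>(1) \<sigma>(1) by (auto simp: representation_def)
  note d = carrier_matD[OF c(1)] carrier_matD[OF c(2)]
  have "representation scale (m + n) \<tau>"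
    unfolding representation_def
  proof (intro conjI allI)
    show "\<tau> h \<in> carrier_mat (m + n) (m + n)" for h
      using c by (simp add: \<tau>_def)
    show "\<tau> (h + h') = \<tau> h + \<tau> h'" for h h'
      unfolding \<tau>_def by (subst add_four_block_mat[OF c(1) _ _ c(2) c(1) _ _ c(2)])
        (use \<rho>(1) \<sigma>(1) in \<open>auto simp: representation_def\<close>)
    show "\<tau> (scale c h) = c \<cdot>\<^sub>m \<tau> h" for c h
      unfolding \<tau>_def by (subst smult_four_block_mat[OF c(1) _ _ c(2)])
        (use \<rho>(1) \<sigma>(1) in \<open>auto simp: representation_def\<close>)
    show "\<tau> 1 = 1\<^sub>m (m + n)"
      using \<rho>(1) \<sigma>(1) by (simp add: \<tau>_def representation_def)
    show "\<tau> (h * h') = \<tau> h * \<tau> h'" for h h'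
    proof -
      have "\<rho> h * 0\<^sub>m m n = 0\<^sub>m m n" "\<sigma> h * 0\<^sub>m n m = 0\<^sub>m n m"
        "0\<^sub>m n m * \<rho> h' = 0\<^sub>m n m" "0\<^sub>m m n * \<sigma> h' = 0\<^sub>m m n"
        "\<rho> h * \<rho> h' \<in> carrier_mat m m" "\<sigma> h * \<sigma> h' \<in> carrier_mat n n"
        using c[of h] c[of h'] by auto
      then show ?thesis
        unfolding \<tau>_def
        by (subst mult_four_block_mat[OF c(1) _ _ c(2) c(1) _ _ c(2)])
          (use \<rho>(1) \<sigma>(1) in \<open>auto simp: representation_def\<close>)
    qed
  qed
  moreover have "f h + g h = character_of \<tau> h" for h
  proof -
    have "(\<Sum>i<m + n. \<tau> h $$ (i, i)) = (\<Sum>i<m. \<rho> h $$ (i, i)) + (\<Sum>i<n. \<sigma> h $$ (i, i))"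
      by (simp add: sum_lessThan_add \<tau>_def d)
    moreover have "dim_row (\<tau> h) = m + n" by (simp add: \<tau>_def d)
    ultimately show ?thesis
      by (simp add: \<rho>(2) \<sigma>(2) character_of_def mat_trace_def d)
  qed
  ultimately show ?thesis
    unfolding is_character_def by blast
qed

lemma is_character_of_nat_mult:
  assumes "is_character scale f"
  shows "is_character scale (\<lambda>h. of_nat c * f h)"
proof (induction c)
  case 0
  show ?case using is_character_zero by simp
next
  case (Suc c)
  show ?case using is_character_add[OF assms Suc] by (simp add: distrib_right)
qed

lemma is_character_nat_combination:
  assumes "finite I" and "\<And>i. i \<in> I \<Longrightarrow> is_character scale (\<chi> i)"
    and "\<And>i. i \<in> I \<Longrightarrow> c i \<in> \<nat>"
  shows "is_character scale (\<lambda>h. \<Sum>i\<in>I. c i * \<chi> i h)"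
  using assms
proof (induction I rule: finite_induct)
  case empty
  show ?case using is_character_zero by simp
next
  case (insert i I)
  obtain n where "c i = of_nat n"
    using insert.prems(2)[of i] by (auto simp: Nats_def)
  then have "is_character scale (\<lambda>h. c i * \<chi> i h)"
    using is_character_of_nat_mult insert.prems(1) by auto
  from is_character_add[OF this insert.IH] insert show ?case by simp
qed

lemma sum_in_Nats:
  assumes "\<And>i. i \<in> A \<Longrightarrow> f i \<in> \<nat>"
  shows "sum f A \<in> \<nat>"
  using assms by (induction A rule: infinite_finite_induct) simp_all

lemma power_in_Nats: "x \<in> \<nat> \<Longrightarrow> x ^ n \<in> \<nat>"
  by (induction n) simp_all

text \<open>
  The map \<open>l \<mapsto> (l div n, l mod n)\<close> identifies the indices below \<open>m * n\<close> with the basis vectors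
  \<open>e\<^sub>p \<otimes> e\<^sub>q\<close> of \<open>k\<^sup>m \<otimes> k\<^sup>n\<close>.
\<close>

lemma sum_div_mod:
  "(\<Sum>l<m * n. F (l div n) (l mod n)) = (\<Sum>p<m. \<Sum>q<n. F p (q::nat))" for m n :: nat
proof -
  have "(\<Sum>l<m * n. F (l div n) (l mod n)) =
      (\<Sum>p<m. \<Sum>l\<in>{p * n..<p * n + n}. F (l div n) (l mod n))"
    by (rule sum.nat_group[symmetric])
  also have "\<dots> = (\<Sum>p<m. \<Sum>q<n. F p q)"
  proof (rule sum.cong[OF refl])
    fix p
    have "(\<Sum>l\<in>{p * n..<p * n + n}. F (l div n) (l mod n)) =
        (\<Sum>q\<in>{0..<n}. F ((q + p * n) div n) ((q + p * n) mod n))"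
      using sum.shift_bounds_nat_ivl[of "\<lambda>l. F (l div n) (l mod n)" 0 "p * n" n]
      by (simp add: add.commute)
    then show "(\<Sum>l\<in>{p * n..<p * n + n}. F (l div n) (l mod n)) = (\<Sum>q<n. F p q)"
      by (simp add: atLeast0LessThan)
  qed
  finally show ?thesis .
qed

context hopf_algebra
begin

text \<open>
  Inside this locale the unqualified name \<open>representation\<close> means the coordinates of a vector in a
  basis, hence the qualified name.
\<close>

lemma matrix_coefficient_linear:
  assumes "Defs.representation scale n \<rho>" and "i < n" and "j < n"
  shows "Vector_Spaces.linear scale (*) (\<lambda>h. \<rho> h $$ (i, j))"
proof -
  have "\<rho> h \<in> carrier_mat n n" for h
    using assms(1) by (simp add: Defs.representation_def)
  note d = carrier_matD[OF this]
  show ?thesis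
    using assms counit_linear by (simp add: Vector_Spaces.linear_iff Defs.representation_def d)
qed

lemma matrix_coefficient_mult:
  assumes "Defs.representation scale n \<rho>" and "i < n" and "j < n"
  shows "\<rho> (g * h) $$ (i, j) = (\<Sum>p<n. \<rho> g $$ (i, p) * \<rho> h $$ (p, j))"
proof -
  have "\<rho> h \<in> carrier_mat n n" for h
    using assms(1) by (simp add: Defs.representation_def)
  note d = carrier_matD[OF this]
  show ?thesis
    using assms by (simp add: Defs.representation_def d scalar_prod_def atLeast0LessThan)
qed

lemma bilinear_map_functionals:
  assumes "Vector_Spaces.linear scale (*) f" and "Vector_Spaces.linear scale (*) g"
  shows "bilinear_map scale (*) (\<lambda>a b. f a * g b)"
  using assms by (simp add: bilinear_map_def Vector_Spaces.linear_iff algebra_simps)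

lemma dual_mult_pair_sum: "dual_mult \<Delta> f g h = pair_sum (\<lambda>a b. f a * g b) (\<Delta> h)"
  by (simp add: dual_mult_def pair_sum_def)

text \<open>
  The action on the dual module is \<open>h \<mapsto> \<rho>(S h)\<^sup>T\<close>: both \<open>S\<close> and the transpose reverse products.
\<close>

lemma is_character_dual_antipode:
  assumes "is_character scale f"
  shows "is_character scale (dual_antipode S f)"
proof -
  obtain n \<rho> where \<rho>: "Defs.representation scale n \<rho>" "f = character_of \<rho>"
    using assms by (auto simp: is_character_def)
  have c: "\<rho> h \<in> carrier_mat n n" for h
    using \<rho>(1) by (simp add: Defs.representation_def)
  note d = carrier_matD[OF c]
  have "Defs.representation scale n (\<lambda>h. transpose_mat (\<rho> (S h)))"
    unfolding Defs.representation_def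
  proof (intro conjI allI)
    show "transpose_mat (\<rho> (S (g * h))) = transpose_mat (\<rho> (S g)) * transpose_mat (\<rho> (S h))" for g h
      using \<rho>(1) transpose_mult[OF c c, of "S h" "S g"]
      by (simp add: antipode_mult Defs.representation_def)
  qed (use \<rho>(1) c in \<open>auto simp: Defs.representation_def antipode_add antipode_scale antipode_one
      transpose_add[OF c c] intro!: eq_matI simp: d\<close>)
  moreover have "dual_antipode S f = character_of (\<lambda>h. transpose_mat (\<rho> (S h)))"
    by (auto simp: dual_antipode_def \<rho>(2) character_of_def mat_trace_def d)
  ultimately show ?thesis
    unfolding is_character_def by blast
qed

text \<open>
  The product is afforded by the tensor product module, on which \<open>h\<close> acts by \<open>\<Sum> \<rho>(h\<^sub>1) \<otimes> \<sigma>(h\<^sub>2)\<close>.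
  The entries of these matrices are products, in the dual algebra, of matrix coefficients of \<open>\<rho>\<close>
  and \<open>\<sigma>\<close>, and compatibility of the coproduct with multiplication makes the action multiplicative.
\<close>

lemma is_character_dual_mult:
  assumes "is_character scale f" and "is_character scale g"
  shows "is_character scale (dual_mult \<Delta> f g)"
proof -
  obtain m \<rho> where \<rho>: "Defs.representation scale m \<rho>" "f = character_of \<rho>"
    using assms(1) by (auto simp: is_character_def)
  obtain n \<sigma> where \<sigma>: "Defs.representation scale n \<sigma>" "g = character_of \<sigma>"
    using assms(2) by (auto simp: is_character_def)
  have d: "dim_row (\<rho> h) = m" "dim_row (\<sigma> h) = n" for h
    using \<rho>(1) \<sigma>(1) by (auto simp: Defs.representation_def)
  define coeff where "coeff p p' q q' = dual_mult \<Delta> (\<lambda>a. \<rho> a $$ (p, p')) (\<lambda>b. \<sigma> b $$ (q, q'))"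
    for p p' q q'
  define \<tau> where "\<tau> h = mat (m * n) (m * n)
    (\<lambda>(i, j). coeff (i div n) (j div n) (i mod n) (j mod n) h)" for h
  have dm: "i div n < m" "i mod n < n" if "i < m * n" for i
  proof -
    have "n > 0" using that by (cases n) auto
    then show "i div n < m" "i mod n < n"
      using that by (auto simp: less_mult_imp_div_less)
  qed
  have bilin: "bilinear_map scale (*) (\<lambda>a b. \<rho> a $$ (p, p') * \<sigma> b $$ (q, q'))"
    if "p < m" "p' < m" "q < n" "q' < n" for p p' q q'
    using that \<rho>(1) \<sigma>(1) by (intro bilinear_map_functionals matrix_coefficient_linear)
  have lin: "Vector_Spaces.linear scale (*) (coeff p p' q q')"
    if "p < m" "p' < m" "q < n" "q' < n" for p p' q q'
    unfolding coeff_def dual_mult_pair_sum by (rule pair_sum_comult_linear[OF bilin[OF that]])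
  have coeff_one: "coeff p p' q q' 1 = (if p = p' \<and> q = q' then 1 else 0)"
    if "p < m" "p' < m" "q < n" "q' < n" for p p' q q'
    unfolding coeff_def dual_mult_pair_sum
    using \<rho>(1) \<sigma>(1) that by (simp add: pair_sum_comult_one[OF bilin[OF that]] Defs.representation_def)
  \<comment> \<open>the multiplication rule of a Kronecker product of matrices, summed over the coproducts\<close>
  have coeff_mult: "coeff p p' q q' (x * y) =
      (\<Sum>r<m. \<Sum>s<n. coeff p r q s x * coeff r p' s q' y)"
    if "p < m" "p' < m" "q < n" "q' < n" for p p' q q' x y
  proof -
    have "coeff p p' q q' (x * y) = pair_sum (\<lambda>a b. pair_sum (\<lambda>c d.
        \<rho> (a * c) $$ (p, p') * \<sigma> (b * d) $$ (q, q')) (\<Delta> y)) (\<Delta> x)"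
      unfolding coeff_def dual_mult_pair_sum by (rule pair_sum_comult_mult[OF bilin[OF that]])
    also have "\<dots> = pair_sum (\<lambda>a b. pair_sum (\<lambda>c d. \<Sum>r<m. \<Sum>s<n.
        (\<rho> a $$ (p, r) * \<sigma> b $$ (q, s)) * (\<rho> c $$ (r, p') * \<sigma> d $$ (s, q'))) (\<Delta> y)) (\<Delta> x)"
      using that
      by (simp add: matrix_coefficient_mult[OF \<rho>(1)] matrix_coefficient_mult[OF \<sigma>(1)]
          sum_product mult_ac)
    also have "\<dots> = (\<Sum>r<m. \<Sum>s<n. coeff p r q s x * coeff r p' s q' y)"
      unfolding coeff_def dual_mult_pair_sum
      by (simp add: pair_sum_sum pair_sum_mult_right) (simp add: pair_sum_mult_left)
    finally show ?thesis .
  qed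
  have "Defs.representation scale (m * n) \<tau>"
    unfolding Defs.representation_def
  proof (intro conjI allI)
    show "\<tau> h \<in> carrier_mat (m * n) (m * n)" for h
      by (simp add: \<tau>_def)
    show "\<tau> (g + h) = \<tau> g + \<tau> h" for g h
      by (rule eq_matI) (use lin dm in \<open>auto simp: \<tau>_def Vector_Spaces.linear_iff\<close>)
    show "\<tau> (scale c h) = c \<cdot>\<^sub>m \<tau> h" for c h
      by (rule eq_matI) (use lin dm in \<open>auto simp: \<tau>_def Vector_Spaces.linear_iff\<close>)
    show "\<tau> 1 = 1\<^sub>m (m * n)"
    proof (rule eq_matI)
      fix i j assume "i < dim_row (1\<^sub>m (m * n) :: 'k mat)" "j < dim_col (1\<^sub>m (m * n) :: 'k mat)"
      moreover have "i div n = j div n \<and> i mod n = j mod n \<longleftrightarrow> i = j"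
        by (metis div_mult_mod_eq)
      ultimately show "\<tau> 1 $$ (i, j) = 1\<^sub>m (m * n) $$ (i, j)"
        using dm by (simp add: \<tau>_def coeff_one)
    qed (auto simp: \<tau>_def)
    show "\<tau> (g * h) = \<tau> g * \<tau> h" for g h
    proof (rule eq_matI)
      fix i j assume "i < dim_row (\<tau> g * \<tau> h)" "j < dim_col (\<tau> g * \<tau> h)"
      then have ij: "i < m * n" "j < m * n" by (auto simp: \<tau>_def)
      have "(\<tau> g * \<tau> h) $$ (i, j) = (\<Sum>l<m * n.
          coeff (i div n) (l div n) (i mod n) (l mod n) g *
          coeff (l div n) (j div n) (l mod n) (j mod n) h)"
        using ij by (simp add: \<tau>_def scalar_prod_def atLeast0LessThan)
      also have "\<dots> = (\<Sum>r<m. \<Sum>s<n.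
          coeff (i div n) r (i mod n) s g * coeff r (j div n) s (j mod n) h)"
        by (rule sum_div_mod)
      also have "\<dots> = \<tau> (g * h) $$ (i, j)"
        using ij dm by (simp add: \<tau>_def coeff_mult)
      finally show "\<tau> (g * h) $$ (i, j) = (\<tau> g * \<tau> h) $$ (i, j)" ..
    qed (auto simp: \<tau>_def)
  qed
  moreover have "dual_mult \<Delta> f g h = character_of \<tau> h" for h
  proof -
    have "character_of \<tau> h = (\<Sum>l<m * n. coeff (l div n) (l div n) (l mod n) (l mod n) h)"
      by (simp add: character_of_def mat_trace_def \<tau>_def)
    also have "\<dots> = (\<Sum>p<m. \<Sum>q<n. coeff p p q q h)"
      by (rule sum_div_mod)
    also have "\<dots> = dual_mult \<Delta> f g h"
      by (simp add: coeff_def dual_mult_pair_sum \<rho>(2) \<sigma>(2) character_of_def mat_trace_def d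
          sum_product pair_sum_sum)
    finally show ?thesis ..
  qed
  ultimately show ?thesis
    unfolding is_character_def by blast
qed

end

section \<open>Characters at idempotents\<close>

text \<open>
  Induction on the number of nonzero rows. If \<open>e \<noteq> 0\<close>, let \<open>v\<close> be a nonzero
  column of \<open>e\<close> and \<open>w\<close> a row of \<open>e\<close>, scaled so that \<open>w v = 1\<close>. Then \<open>e v = v\<close> and \<open>w e = w\<close>, so the
  rank-one matrix \<open>v w\<close> is an idempotent of trace \<open>1\<close> and \<open>e - v w\<close> is again idempotent. Subtracting
  \<open>v w\<close> clears the row from which \<open>w\<close> was taken and keeps zero rows zero.
\<close>

lemma trace_idempotent_in_Nats:
  fixes e :: "'a \<Rightarrow> 'a \<Rightarrow> 'k::field"
  assumes "finite A"
    and "\<And>i j. i \<in> A \<Longrightarrow> j \<in> A \<Longrightarrow> (\<Sum>l\<in>A. e i l * e l j) = e i j"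
  shows "(\<Sum>i\<in>A. e i i) \<in> \<nat>"
  using assms(2)
proof (induction "card {i \<in> A. \<exists>j\<in>A. e i j \<noteq> 0}" arbitrary: e rule: less_induct)
  case less
  show ?case
  proof (cases "\<exists>k\<in>A. \<exists>q\<in>A. e k q \<noteq> 0")
    case False
    then have "(\<Sum>i\<in>A. e i i) = 0" by (intro sum.neutral) auto
    then show ?thesis by simp
  next
    case True
    then obtain k q where k: "k \<in> A" and q: "q \<in> A" and nz: "e k q \<noteq> 0" by blast
    \<comment> \<open>With \<open>v\<close> the \<open>q\<close>-th column, \<open>w v\<close> is the \<open>q\<close>-th entry of \<open>w e = w\<close>, which this scaling makes \<open>1\<close>.\<close>
    define w where "w j = e k j / e k q" for j
    define f where "f i j = e i j - e i q * w j" for i j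
    have w_e: "(\<Sum>l\<in>A. w l * e l j) = w j" if "j \<in> A" for j
      using less.prems[OF k that] by (simp add: w_def flip: sum_divide_distrib)
    have w_q: "w q = 1" using nz by (simp add: w_def)
    have idem: "(\<Sum>l\<in>A. f i l * f l j) = f i j" if "i \<in> A" "j \<in> A" for i j
    proof -
      have "(\<Sum>l\<in>A. f i l * f l j) = (\<Sum>l\<in>A. e i l * e l j - (e i l * e l q) * w j
          - e i q * (w l * e l j) + e i q * (w l * e l q) * w j)"
        by (intro sum.cong) (auto simp: f_def algebra_simps)
      also have "\<dots> = e i j - e i q * w j - e i q * w j + e i q * w q * w j"
        using that q
        by (simp add: sum.distrib sum_subtractf less.prems w_e
            flip: sum_distrib_left sum_distrib_right)
      also have "\<dots> = f i j" by (simp add: f_def w_q)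
      finally show ?thesis .
    qed
    have "{i \<in> A. \<exists>j\<in>A. f i j \<noteq> 0} \<subset> {i \<in> A. \<exists>j\<in>A. e i j \<noteq> 0}"
    proof (rule psubsetI)
      show "{i \<in> A. \<exists>j\<in>A. f i j \<noteq> 0} \<subseteq> {i \<in> A. \<exists>j\<in>A. e i j \<noteq> 0}"
      proof -
        have "f i j = 0" if "\<forall>j\<in>A. e i j = 0" "j \<in> A" for i j
          using that q by (simp add: f_def)
        then show ?thesis by blast
      qed
      have "f k j = 0" for j using nz by (simp add: f_def w_def)
      then show "{i \<in> A. \<exists>j\<in>A. f i j \<noteq> 0} \<noteq> {i \<in> A. \<exists>j\<in>A. e i j \<noteq> 0}"
        using k q nz by blast
    qed
    then have "(\<Sum>i\<in>A. f i i) \<in> \<nat>"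
      using assms(1) by (intro less.hyps idem psubset_card_mono) auto
    moreover have "(\<Sum>i\<in>A. f i i) = (\<Sum>i\<in>A. e i i) - 1"
      using w_e[OF q] by (simp add: f_def sum_subtractf w_q mult.commute)
    ultimately have "(\<Sum>i\<in>A. e i i) - 1 + 1 \<in> \<nat>"
      by (metis Nats_add Nats_1)
    then show ?thesis by simp
  qed
qed

lemma character_idempotent_in_Nats:
  assumes "is_character scale f" and "x * x = x"
  shows "f x \<in> \<nat>"
proof -
  obtain n \<rho> where \<rho>: "Defs.representation scale n \<rho>" "f = character_of \<rho>"
    using assms(1) by (auto simp: is_character_def)
  have c: "\<rho> x \<in> carrier_mat n n" and "\<rho> x = \<rho> x * \<rho> x"
    using \<rho>(1) assms(2) by (auto simp: representation_def) metis
  have "(\<Sum>l<n. \<rho> x $$ (i, l) * \<rho> x $$ (l, j)) = \<rho> x $$ (i, j)" if "i < n" "j < n" for i j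
  proof -
    have "(\<rho> x * \<rho> x) $$ (i, j) = (\<Sum>l<n. \<rho> x $$ (i, l) * \<rho> x $$ (l, j))"
      using that c by (simp add: scalar_prod_def atLeast0LessThan)
    then show ?thesis by (simp flip: \<open>\<rho> x = \<rho> x * \<rho> x\<close>)
  qed
  then have "(\<Sum>i<n. \<rho> x $$ (i, i)) \<in> \<nat>"
    by (intro trace_idempotent_in_Nats) auto
  then show ?thesis
    using c by (simp add: \<rho>(2) character_of_def mat_trace_def)
qed

section \<open>The three functions are characters\<close>

theorem theorem4p7:
  fixes scale :: "'k::{alg_closed_field, field_char_0} \<Rightarrow> 'h::ring_1 \<Rightarrow> 'h"
    and \<Delta> :: "'h \<Rightarrow> ('h \<times> 'h) list" and \<epsilon> :: "'h \<Rightarrow> 'k" and S :: "'h \<Rightarrow> 'h"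
    and \<Lambda> :: 'h and d :: nat
    and I :: "'i set" and deg :: "'i \<Rightarrow> nat" and \<rho> :: "'i \<Rightarrow> 'h \<Rightarrow> 'k mat"
    and \<chi> :: "'i \<Rightarrow> 'h \<Rightarrow> 'k"
  assumes "hopf_algebra scale \<Delta> \<epsilon> S"
    and "finite_dimensional scale"
    and "d = vector_space.dim scale (UNIV :: 'h set)"
    and "semisimple_ring TYPE('h)"
    and "idempotent_integral scale \<epsilon> \<Lambda>"
    and "irreducible_modules scale I deg \<rho>"
    and "\<And>i. i \<in> I \<Longrightarrow> \<chi> i = character_of (\<rho> i)"
    and "\<And>i. i \<in> I \<Longrightarrow> deg i dvd d"
  shows "is_character scale (\<lambda>h. \<Sum>i\<in>I. of_nat d / of_nat (deg i) * \<chi> i h) \<and>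
     (\<forall>n\<ge>1. is_character scale
        (\<lambda>h. \<Sum>i\<in>I. (of_nat d / of_nat (deg i)) ^ (2 * n - 1) * \<chi> i h)) \<and>
     is_character scale
        (\<lambda>h. of_nat d ^ 2 * (\<Sum>i\<in>I. \<Sum>j\<in>I.
           1 / (of_nat (deg i) * of_nat (deg j)) *
           dual_mult \<Delta> (dual_mult \<Delta> (\<chi> i) (dual_antipode S (\<chi> i))) (\<chi> j) \<Lambda> * \<chi> i h))"
proof -
  interpret hopf_algebra scale \<Delta> \<epsilon> S by (rule assms(1))
  have finite_I: "finite I"
    using assms(6) by (simp add: irreducible_modules_def)
  have irreducible: "irreducible_representation scale (deg i) (\<rho> i)" if "i \<in> I" for i
    using assms(6) that by (simp add: irreducible_modules_def)
  have \<chi>: "is_character scale (\<chi> i)" if "i \<in> I" for i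
    using irreducible[OF that] assms(7)[OF that]
    by (auto simp: is_character_def irreducible_representation_def)
  have quotient: "(of_nat d / of_nat (deg i) :: 'k) \<in> \<nat>" if i: "i \<in> I" for i
  proof -
    obtain k where "d = deg i * k" using assms(8)[OF i] by (auto elim: dvdE)
    moreover have "deg i > 0"
      using irreducible[OF i] by (simp add: irreducible_representation_def)
    ultimately show ?thesis by simp
  qed
  have \<Lambda>: "\<Lambda> * \<Lambda> = \<Lambda>"
    using assms(5) by (simp add: idempotent_integral_def)
  let ?N = "\<lambda>i j. dual_mult \<Delta> (dual_mult \<Delta> (\<chi> i) (dual_antipode S (\<chi> i))) (\<chi> j) \<Lambda>"
  have multiplicity: "?N i j \<in> \<nat>" if "i \<in> I" "j \<in> I" for i j
    using that \<Lambda>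
    by (intro character_idempotent_in_Nats[where scale = scale] is_character_dual_mult
        is_character_dual_antipode \<chi>)
  have "is_character scale (\<lambda>h. \<Sum>i\<in>I.
      (\<Sum>j\<in>I. of_nat d / of_nat (deg i) * (of_nat d / of_nat (deg j)) * ?N i j) * \<chi> i h)"
    by (intro is_character_nat_combination finite_I \<chi> sum_in_Nats Nats_mult quotient multiplicity)
  moreover have "(\<Sum>i\<in>I.
      (\<Sum>j\<in>I. of_nat d / of_nat (deg i) * (of_nat d / of_nat (deg j)) * ?N i j) * \<chi> i h) =
      of_nat d ^ 2 * (\<Sum>i\<in>I. \<Sum>j\<in>I. 1 / (of_nat (deg i) * of_nat (deg j)) * ?N i j * \<chi> i h)" for h
    by (simp add: sum_distrib_left sum_distrib_right power2_eq_square mult_ac)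
  ultimately have "is_character scale (\<lambda>h. of_nat d ^ 2 *
      (\<Sum>i\<in>I. \<Sum>j\<in>I. 1 / (of_nat (deg i) * of_nat (deg j)) * ?N i j * \<chi> i h))"
    by simp
  moreover have "is_character scale (\<lambda>h. \<Sum>i\<in>I. of_nat d / of_nat (deg i) * \<chi> i h)"
    by (intro is_character_nat_combination finite_I \<chi> quotient)
  moreover have "is_character scale
      (\<lambda>h. \<Sum>i\<in>I. (of_nat d / of_nat (deg i)) ^ (2 * n - 1) * \<chi> i h)" for n
    by (intro is_character_nat_combination finite_I \<chi> power_in_Nats quotient)
  ultimately show ?thesis by blast
qed

end
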